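(* Let $\gamma$ be a smooth plane curve, $\alpha\in(0,1)$, and let $p_1,p_2$ be two points of $\gamma$ with local parametrizations $$\gamma_1(t)=\left(t,\ \tfrac12t^2+a_3t^3+a_4t^4+a_5t^5+O(t^6)\right),\qquad \gamma_2(s)=\left(s,\ b_0+b_1s+b_2s^2+b_3s^3+b_4s^4+b_5s^5+O(s^6)\right),$$ with $b_0>0$, $a_3>0$. If the tangent lines of $\gamma$ at the points $p_1$ and $p_2$ (at $t=0$ and $s=0$) are parallel (so $b_1=0$), then the IPTL of $\gamma$, parametrized locally by $s$: (1) passes through the point $M_\alpha(0,0)=(0,\alpha b_0)$; (2) is regular at $s=0$ if and only if $b_2\neq\dfrac{\alpha}{2(\alpha-1)}$; (3) has an ordinary cusp singularity at $s=0$ if and only if $$b_2=\frac{\alpha}{2(\alpha-1)}\quad\text{and}\quad b_3\neq\left(\frac{\alpha}{\alpha-1}\right)^2a_3;$$ (4) has a $(3,4)$-cusp singularity at $s=0$ if and only if $$b_2=\frac{\alpha}{2(\alpha-1)},\quad b_3=\left(\frac{\alpha}{\alpha-1}\right)^2a_3\quad\text{and}\quad b_4\neq\left(\frac{\alpha}{\alpha-1}\right)^3a_4.$$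
   Context: The intermediate point of the pair $(\gamma_1(t),\gamma_2(s))$ is $M_\alpha(t,s)=(1-\alpha)\gamma_1(t)+\alpha\gamma_2(s)$. For a pair with parallel tangent lines, the intermediate line is the line through $M_\alpha$ parallel to the two tangents. The IPTL (Intermediate-Parallel Tangent Locus) is the part of the envelope of intermediate lines coming from pairs of distinct points with parallel tangent lines. Locally, near $(t,s)=(0,0)$, the pairs with parallel tangents are those with $\gamma_1'(t)\parallel\gamma_2'(s)$, which defines a smooth function $t=t(s)$, $t(0)=0$ (with $t=2b_2s+(3b_3-12a_3b_2^2)s^2+O(s^3)$); the corresponding envelope point is $M_\alpha(t(s),s)$, so the IPTL is the parametrized curve $s\mapsto M_\alpha(t(s),s)$. A parametrized plane curve $\theta$ is regular at $0$ if $\theta'(0)\neq0$; it has an ordinary cusp at $0$ if $\theta'(0)=0$ and $[\theta^{(2)}(0),\theta^{(3)}(0)]\neq0$; it has a $(3,4)$-cusp at $0$ if $\theta'(0)=0$, $[\theta^{(2)}(0),\theta^{(3)}(0)]=0$ and $[\theta^{(3)}(0),\theta^{(4)}(0)]\neq0$, where $[\cdot,\cdot]$ is the $2\times2$ determinant. *)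

theory Defs
  imports "HOL-Analysis.Analysis" "HOL-Library.Landau_Symbols"
begin

definition nth_vderiv :: "nat \<Rightarrow> (real \<Rightarrow> 'a::real_normed_vector) \<Rightarrow> real \<Rightarrow> 'a" where
  "nth_vderiv n f = ((\<lambda>g t. vector_derivative g (at t)) ^^ n) f"

(* C^infinity; meant for open S, since the derivatives are two-sided. *)
definition smooth_on :: "real set \<Rightarrow> (real \<Rightarrow> 'a::real_normed_vector) \<Rightarrow> bool" where
  "smooth_on S f \<longleftrightarrow> (\<forall>n. \<forall>t\<in>S. nth_vderiv n f differentiable (at t))"

definition smooth_near :: "(real \<Rightarrow> 'a::real_normed_vector) \<Rightarrow> real \<Rightarrow> bool" where
  "smooth_near f t0 \<longleftrightarrow> (\<exists>S. open S \<and> t0 \<in> S \<and> smooth_on S f)"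

(* A smooth plane curve is a regular parametrized curve.  The domain is an arbitrary open set,
   so that several components are allowed; a closed curve is covered by a periodic map. *)
definition smooth_plane_curve :: "real set \<Rightarrow> (real \<Rightarrow> real \<times> real) \<Rightarrow> bool" where
  "smooth_plane_curve I \<gamma> \<longleftrightarrow>
     open I \<and> smooth_on I \<gamma> \<and> (\<forall>u\<in>I. vector_derivative \<gamma> (at u) \<noteq> 0)"

(* g reparametrizes, near the parameter 0, the branch of the curve at the point with parameter u.
   The orientation may be reversed. *)
definition local_parametrization ::
  "(real \<Rightarrow> real \<times> real) \<Rightarrow> real \<Rightarrow> (real \<Rightarrow> real \<times> real) \<Rightarrow> bool" where
  "local_parametrization \<gamma> u g \<longleftrightarrow>
     smooth_near g 0 \<and>
     (\<exists>\<phi>. smooth_near \<phi> 0 \<and> \<phi> 0 = u \<and> vector_derivative \<phi> (at 0) \<noteq> 0 \<and>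
          (\<forall>\<^sub>F t in nhds 0. g t = \<gamma> (\<phi> t)))"

definition tangent_line :: "(real \<Rightarrow> real \<times> real) \<Rightarrow> real \<Rightarrow> (real \<times> real) set" where
  "tangent_line g t = range (\<lambda>c. g t + c *\<^sub>R vector_derivative g (at t))"

definition intermediate_point ::
  "real \<Rightarrow> (real \<Rightarrow> real \<times> real) \<Rightarrow> (real \<Rightarrow> real \<times> real) \<Rightarrow> real \<Rightarrow> real \<Rightarrow> real \<times> real" where
  "intermediate_point \<alpha> g1 g2 t s = (1 - \<alpha>) *\<^sub>R g1 t + \<alpha> *\<^sub>R g2 s"

definition parallel_tangent_pair ::
  "(real \<Rightarrow> real \<times> real) \<Rightarrow> (real \<Rightarrow> real \<times> real) \<Rightarrow> real \<Rightarrow> real \<Rightarrow> bool" where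
  "parallel_tangent_pair g1 g2 t s \<longleftrightarrow>
     g1 t \<noteq> g2 s \<and> affine_parallel (tangent_line g1 t) (tangent_line g2 s)"

(* Near (0,0), the parallel tangent pairs are exactly the graph t = \<tau>(s). *)
definition parallel_tangent_function ::
  "(real \<Rightarrow> real \<times> real) \<Rightarrow> (real \<Rightarrow> real \<times> real) \<Rightarrow> (real \<Rightarrow> real) \<Rightarrow> bool" where
  "parallel_tangent_function g1 g2 \<tau> \<longleftrightarrow>
     smooth_near \<tau> 0 \<and> \<tau> 0 = 0 \<and>
     (\<forall>\<^sub>F (t, s) in nhds (0, 0). parallel_tangent_pair g1 g2 t s \<longleftrightarrow> t = \<tau> s)"

(* The line through M(\<tau>(s),s) parallel to the two tangents touches the curve
   s \<mapsto> M(\<tau>(s),s), which is therefore the part of the envelope of the intermediate lines that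
   comes from the parallel tangent pairs.  Only its germ at s = 0 is determined. *)
definition local_IPTL ::
  "real \<Rightarrow> (real \<Rightarrow> real \<times> real) \<Rightarrow> (real \<Rightarrow> real \<times> real) \<Rightarrow> (real \<Rightarrow> real \<times> real) \<Rightarrow> bool" where
  "local_IPTL \<alpha> g1 g2 \<theta> \<longleftrightarrow>
     (\<exists>\<tau>. parallel_tangent_function g1 g2 \<tau> \<and>
          (\<forall>\<^sub>F s in nhds 0. \<theta> s = intermediate_point \<alpha> g1 g2 (\<tau> s) s))"

definition det2 :: "real \<times> real \<Rightarrow> real \<times> real \<Rightarrow> real" where
  "det2 u v = fst u * snd v - snd u * fst v"

definition regular_at :: "(real \<Rightarrow> real \<times> real) \<Rightarrow> real \<Rightarrow> bool" where
  "regular_at \<theta> s \<longleftrightarrow> nth_vderiv 1 \<theta> s \<noteq> 0"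

definition ordinary_cusp_at :: "(real \<Rightarrow> real \<times> real) \<Rightarrow> real \<Rightarrow> bool" where
  "ordinary_cusp_at \<theta> s \<longleftrightarrow>
     nth_vderiv 1 \<theta> s = 0 \<and> det2 (nth_vderiv 2 \<theta> s) (nth_vderiv 3 \<theta> s) \<noteq> 0"

definition cusp34_at :: "(real \<Rightarrow> real \<times> real) \<Rightarrow> real \<Rightarrow> bool" where
  "cusp34_at \<theta> s \<longleftrightarrow>
     nth_vderiv 1 \<theta> s = 0 \<and> det2 (nth_vderiv 2 \<theta> s) (nth_vderiv 3 \<theta> s) = 0 \<and>
     det2 (nth_vderiv 3 \<theta> s) (nth_vderiv 4 \<theta> s) \<noteq> 0"

end

theory Submission
  imports Defs "HOL-Computational_Algebra.Polynomial"
begin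

text \<open>Let \<open>f\<close>, \<open>g\<close> be the height functions of the two graphs. The parallel pairs near \<open>(0, 0)\<close>
  solve \<open>f' t = g' s\<close>, and \<open>f'' 0 = 1\<close> makes \<open>t = \<tau> s\<close> a smooth function. Since
  \<open>f' (\<tau> s) = g' s\<close>, the IPTL has velocity \<open>h s *\<^sub>R (1, g' s)\<close> with
  \<open>h = (1 - \<alpha>) * \<tau>' + \<alpha>\<close>. As \<open>g' 0 = 0\<close>, the determinant \<open>[\<theta>'', \<theta>''']\<close> is
  \<open>2 * h'\<^sup>2 * g''\<close> at \<open>0\<close> if \<open>h 0 = 0\<close>, and \<open>[\<theta>''', \<theta>'''']\<close> is
  \<open>3 * h''\<^sup>2 * g''\<close> if also \<open>h' 0 = 0\<close>; here \<open>g'' 0 = \<alpha> / (\<alpha> - 1) \<noteq> 0\<close>. So the type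
  of the singularity is the order of vanishing of \<open>h\<close>, which is found by differentiating
  \<open>f' (\<tau> s) = g' s\<close>.\<close>

section \<open>Iterated derivatives and a criterion for smoothness\<close>

lemma nth_vderiv_0 [simp]: "nth_vderiv 0 f = f"
  by (simp add: nth_vderiv_def)

lemma nth_vderiv_Suc: "nth_vderiv (Suc n) f t = vector_derivative (nth_vderiv n f) (at t)"
  by (simp add: nth_vderiv_def)

lemma nth_vderiv_nth_vderiv: "nth_vderiv m (nth_vderiv n f) = nth_vderiv (m + n) f"
  by (simp add: nth_vderiv_def funpow_add)

lemma smooth_on_has_vector_derivative:
  assumes "smooth_on S f" "t \<in> S"
  shows "(nth_vderiv n f has_vector_derivative nth_vderiv (Suc n) f t) (at t)"
  using assms by (auto simp: smooth_on_def nth_vderiv_Suc vector_derivative_works)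

lemma smooth_on_has_real_derivative:
  fixes f :: "real \<Rightarrow> real"
  assumes "smooth_on S f" "t \<in> S"
  shows "(nth_vderiv n f has_real_derivative nth_vderiv (Suc n) f t) (at t)"
  using smooth_on_has_vector_derivative[OF assms]
  by (simp add: has_real_derivative_iff_has_vector_derivative)

lemma smooth_on_subset: "smooth_on S f \<Longrightarrow> T \<subseteq> S \<Longrightarrow> smooth_on T f"
  by (auto simp: smooth_on_def)

lemma smooth_near_nth_vderiv:
  assumes "smooth_near f t"
  shows "smooth_near (nth_vderiv n f) t"
  using assms by (auto simp: smooth_near_def smooth_on_def nth_vderiv_nth_vderiv)

lemma smooth_near_has_real_derivative:
  fixes f :: "real \<Rightarrow> real"
  assumes "smooth_near f x"
  shows "\<forall>\<^sub>F t in nhds x. (nth_vderiv n f has_real_derivative nth_vderiv (Suc n) f t) (at t)"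
  using assms smooth_on_has_real_derivative
  unfolding smooth_near_def eventually_nhds by metis

text \<open>Reduces smoothness to a single differentiation step: by induction every iterated
  derivative agrees on \<open>S\<close> with a member of \<open>\<A>\<close>. Openness of
  \<open>S\<close> lets this agreement pass to the two-sided derivatives.\<close>

lemma smooth_on_family:
  assumes "open S" and "f \<in> \<A>"
    and step: "\<And>h. h \<in> \<A> \<Longrightarrow> \<exists>h'\<in>\<A>. \<forall>t\<in>S. (h has_vector_derivative h' t) (at t)"
  shows "smooth_on S f"
proof -
  have der: "(nth_vderiv n f has_vector_derivative h' t) (at t)"
    if "\<forall>t\<in>S. nth_vderiv n f t = h t" "\<forall>t\<in>S. (h has_vector_derivative h' t) (at t)" "t \<in> S"
    for n h h' t
    by (rule has_vector_derivative_transform_within_open[of h _ _ S]) (use that \<open>open S\<close> in auto)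
  have ex: "\<exists>h\<in>\<A>. \<forall>t\<in>S. nth_vderiv n f t = h t" for n
  proof (induction n)
    case 0
    then show ?case using \<open>f \<in> \<A>\<close> by auto
  next
    case (Suc n)
    then obtain h where h: "h \<in> \<A>" "\<forall>t\<in>S. nth_vderiv n f t = h t" by blast
    obtain h' where h': "h' \<in> \<A>" "\<forall>t\<in>S. (h has_vector_derivative h' t) (at t)"
      using step[OF h(1)] by blast
    have "\<forall>t\<in>S. nth_vderiv (Suc n) f t = h' t"
      using der[OF h(2) h'(2)] by (simp add: nth_vderiv_Suc vector_derivative_at)
    with h'(1) show ?case by blast
  qed
  show ?thesis
    unfolding smooth_on_def
  proof (intro allI ballI)
    fix n t assume "t \<in> S"
    obtain h where h: "h \<in> \<A>" "\<forall>t\<in>S. nth_vderiv n f t = h t" using ex by blast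
    obtain h' where "\<forall>t\<in>S. (h has_vector_derivative h' t) (at t)"
      using step[OF h(1)] by blast
    from der[OF h(2) this \<open>t \<in> S\<close>] show "nth_vderiv n f differentiable (at t)"
      by (rule differentiableI_vector)
  qed
qed

lemma smooth_on_bounded_linear:
  assumes "open S" "smooth_on S f" "bounded_linear L"
  shows "smooth_on S (\<lambda>t. L (f t))"
proof (rule smooth_on_family[where \<A> = "range (\<lambda>n t. L (nth_vderiv n f t))"])
  show "(\<lambda>t. L (f t)) \<in> range (\<lambda>n t. L (nth_vderiv n f t))"
    by (rule range_eqI[of _ _ 0]) simp
  fix h assume "h \<in> range (\<lambda>n t. L (nth_vderiv n f t))"
  then obtain n where h: "h = (\<lambda>t. L (nth_vderiv n f t))" by blast
  have "\<forall>t\<in>S. (h has_vector_derivative L (nth_vderiv (Suc n) f t)) (at t)"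
    unfolding h
    using bounded_linear.has_vector_derivative[OF assms(3)]
      smooth_on_has_vector_derivative[OF assms(2)] by blast
  then show "\<exists>h'\<in>range (\<lambda>n t. L (nth_vderiv n f t)). \<forall>t\<in>S. (h has_vector_derivative h' t) (at t)"
    by (intro bexI[of _ "\<lambda>t. L (nth_vderiv (Suc n) f t)"] range_eqI[of _ _ "Suc n"]) auto
qed fact

section \<open>The implicit function theorem for separated variables\<close>

text \<open>If \<open>\<tau>' = G' / (F' \<circ> \<tau>)\<close>, then these functions are closed under differentiation,
  which makes \<open>\<tau>\<close> smooth.\<close>
inductive_set implicit_algebra ::
  "(real \<Rightarrow> real) \<Rightarrow> (real \<Rightarrow> real) \<Rightarrow> (real \<Rightarrow> real) \<Rightarrow> (real \<Rightarrow> real) set"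
  for F G \<tau> where
  base: "\<tau> \<in> implicit_algebra F G \<tau>"
| left: "(\<lambda>s. nth_vderiv n F (\<tau> s)) \<in> implicit_algebra F G \<tau>"
| right: "nth_vderiv n G \<in> implicit_algebra F G \<tau>"
| inv: "(\<lambda>s. inverse (nth_vderiv 1 F (\<tau> s))) \<in> implicit_algebra F G \<tau>"
| const: "(\<lambda>s. c) \<in> implicit_algebra F G \<tau>"
| plus: "u \<in> implicit_algebra F G \<tau> \<Longrightarrow> v \<in> implicit_algebra F G \<tau> \<Longrightarrow>
    (\<lambda>s. u s + v s) \<in> implicit_algebra F G \<tau>"
| times: "u \<in> implicit_algebra F G \<tau> \<Longrightarrow> v \<in> implicit_algebra F G \<tau> \<Longrightarrow>
    (\<lambda>s. u s * v s) \<in> implicit_algebra F G \<tau>"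

text \<open>The formula in \<open>der\<close> is a member of
  \<open>implicit_algebra F G \<tau>\<close>. An induction over the generation of that set therefore
  gives each member a derivative in the same set, and \<open>smooth_on_family\<close>
  applies.\<close>

lemma smooth_on_implicit:
  fixes F G \<tau> :: "real \<Rightarrow> real"
  assumes "open S" and F: "smooth_on T F" and G: "smooth_on S G" and \<tau>: "\<tau> ` S \<subseteq> T"
    and nz: "\<And>s. s \<in> S \<Longrightarrow> nth_vderiv 1 F (\<tau> s) \<noteq> 0"
    and der: "\<And>s. s \<in> S \<Longrightarrow>
      (\<tau> has_real_derivative nth_vderiv 1 G s * inverse (nth_vderiv 1 F (\<tau> s))) (at s)"
  shows "smooth_on S \<tau>"
proof (rule smooth_on_family[OF \<open>open S\<close> implicit_algebra.base[of \<tau> F G]])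
  let ?A = "implicit_algebra F G \<tau>" and ?r = "\<lambda>s. inverse (nth_vderiv 1 F (\<tau> s))"
  let ?\<tau>' = "\<lambda>s. nth_vderiv 1 G s * ?r s"
  have \<tau>': "?\<tau>' \<in> ?A" by (intro implicit_algebra.intros)
  have derF: "((\<lambda>s. nth_vderiv n F (\<tau> s)) has_real_derivative
      nth_vderiv (Suc n) F (\<tau> s) * ?\<tau>' s) (at s)" if "s \<in> S" for n s
    using DERIV_chain2[OF smooth_on_has_real_derivative[OF F] der[OF that]] that \<tau> by blast
  fix h assume "h \<in> ?A"
  then have "\<exists>h'\<in>?A. \<forall>s\<in>S. (h has_real_derivative h' s) (at s)"
  proof induction
    case base
    show ?case using der by (intro bexI[OF _ \<tau>']) auto
  next
    case (left n)
    show ?case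
      using derF by (intro bexI[OF _ implicit_algebra.times[OF implicit_algebra.left[of "Suc n"] \<tau>']]) auto
  next
    case (right n)
    show ?case
      using smooth_on_has_real_derivative[OF G]
      by (intro bexI[OF _ implicit_algebra.right[of "Suc n"]]) auto
  next
    case inv
    \<comment> \<open>The derivative -u'/u^2 of 1/u, spelled with the constant -1 and products so
      that membership follows from the introduction rules.\<close>
    have A: "(\<lambda>s. - 1 * ((nth_vderiv (Suc 1) F (\<tau> s) * ?\<tau>' s) * (?r s * ?r s))) \<in> ?A"
      by (rule implicit_algebra.times[OF implicit_algebra.const implicit_algebra.times[OF
        implicit_algebra.times[OF implicit_algebra.left \<tau>']
        implicit_algebra.times[OF implicit_algebra.inv implicit_algebra.inv]]])
    show ?case
    proof (intro bexI[OF _ A] ballI)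
      fix s assume s: "s \<in> S"
      show "(?r has_real_derivative
          - 1 * ((nth_vderiv (Suc 1) F (\<tau> s) * ?\<tau>' s) * (?r s * ?r s))) (at s)"
        by (rule DERIV_cong[OF DERIV_inverse_fun[OF derF[OF s] nz[OF s]]]) simp
    qed
  next
    case (const c)
    show ?case by (rule bexI[OF _ implicit_algebra.const[of 0]]) auto
  next
    case (plus u v)
    then obtain u' v' where uv: "u' \<in> ?A" "\<forall>s\<in>S. (u has_real_derivative u' s) (at s)"
      "v' \<in> ?A" "\<forall>s\<in>S. (v has_real_derivative v' s) (at s)" by blast
    show ?case
      by (rule bexI[OF _ implicit_algebra.plus[OF uv(1) uv(3)]]) (use uv in \<open>auto intro: DERIV_add\<close>)
  next
    case (times u v)
    then obtain u' v' where uv: "u' \<in> ?A" "\<forall>s\<in>S. (u has_real_derivative u' s) (at s)"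
      "v' \<in> ?A" "\<forall>s\<in>S. (v has_real_derivative v' s) (at s)" by blast
    have A: "(\<lambda>s. u' s * v s + v' s * u s) \<in> ?A"
      by (rule implicit_algebra.plus[OF implicit_algebra.times[OF uv(1) times(2)]
        implicit_algebra.times[OF uv(3) times(1)]])
    show ?case
      by (rule bexI[OF _ A]) (use uv in \<open>auto intro: DERIV_mult\<close>)
  qed
  then show "\<exists>h'\<in>?A. \<forall>s\<in>S. (h has_vector_derivative h' s) (at s)"
    by (simp add: has_real_derivative_iff_has_vector_derivative)
qed

text \<open>Since the variables are separated, inverting a function of one variable suffices: \<tau>
  is \<open>G\<close> followed by the local inverse of \<open>F\<close> near
  \<open>t0\<close>.\<close>

lemma smooth_implicit_function:
  fixes F G :: "real \<Rightarrow> real"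
  assumes F: "smooth_near F t0" and G: "smooth_near G s0" and eq: "F t0 = G s0"
    and nz: "nth_vderiv 1 F t0 \<noteq> 0"
  obtains \<tau> where "smooth_near \<tau> s0" "\<tau> s0 = t0"
    "\<forall>\<^sub>F (t, s) in nhds (t0, s0). F t = G s \<longleftrightarrow> t = \<tau> s"
proof -
  obtain T where T: "open T" "t0 \<in> T" "smooth_on T F"
    using F by (auto simp: smooth_near_def)
  obtain S where S: "open S" "s0 \<in> S" "smooth_on S G"
    using G by (auto simp: smooth_near_def)
  have contF: "continuous_on T (nth_vderiv n F)" for n
    using smooth_on_has_real_derivative[OF T(3)]
    by (auto intro!: continuous_at_imp_continuous_on DERIV_isCont)
  have contG: "continuous_on S G"
    using smooth_on_has_real_derivative[OF S(3), of _ 0]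
    by (auto intro!: continuous_at_imp_continuous_on DERIV_isCont)
  have "open (T \<inter> nth_vderiv 1 F -` (- {0}))"
    using continuous_open_preimage[OF contF \<open>open T\<close>] by blast
  \<comment> \<open>The neighbourhood is a ball because the mean value argument below needs the
    segment between any two of its points.\<close>
  then obtain r where r: "r > 0" "ball t0 r \<subseteq> T \<inter> nth_vderiv 1 F -` (- {0})"
    using T nz by (metis ComplI IntI empty_iff insert_iff open_contains_ball vimageI)
  define U where "U = ball t0 r"
  have U: "open U" "t0 \<in> U" "smooth_on U F" "\<And>t. t \<in> U \<Longrightarrow> nth_vderiv 1 F t \<noteq> 0"
    using r smooth_on_subset[OF T(3)] by (auto simp: U_def)
  have derF: "(F has_real_derivative nth_vderiv 1 F t) (at t)" if "t \<in> U" for t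
    using smooth_on_has_real_derivative[OF U(3) that, of 0] by simp
  have contFU: "continuous_on U F"
    using derF by (auto intro!: continuous_at_imp_continuous_on DERIV_isCont)
  \<comment> \<open>Rolle's argument: equal values would force a zero of the derivative of
    \<open>F\<close> in between.\<close>
  have no: "F x \<noteq> F y" if "x \<in> U" "y \<in> U" "x < y" for x y
  proof
    assume eq: "F x = F y"
    have sub: "{x..y} \<subseteq> U"
      using that closed_segment_subset[of x U y] by (simp add: U_def closed_segment_eq_real_ivl)
    obtain z where "x < z" "z < y" "F y - F x = (y - x) * nth_vderiv 1 F z"
      using MVT2[OF \<open>x < y\<close>, of F "nth_vderiv 1 F"] derF sub by (meson atLeastAtMost_iff subsetD)
    moreover from this sub have "z \<in> U" by auto
    ultimately show False using eq U(4)[of z] \<open>x < y\<close> by simp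
  qed
  have inj: "inj_on F U"
    using no by (metis inj_onI linorder_neqE)
  define H where "H = inv_into U F"
  have H: "H (F t) = t" if "t \<in> U" for t
    using inj that by (simp add: H_def)
  have FH: "F (H v) = v" "H v \<in> U" if "v \<in> F ` U" for v
    using that by (auto simp: H)
  \<comment> \<open>Invariance of domain makes the image open, so each of its points has around it
    the interval that the rule for derivatives of inverses asks for.\<close>
  have oV: "open (F ` U)" using invariance_of_domain[OF contFU U(1) inj] .
  have contH: "continuous_on (F ` U) H"
    by (rule continuous_on_inverse_open[OF U(1) contFU]) (auto simp: H)
  have derH: "(H has_real_derivative inverse (nth_vderiv 1 F (H v))) (at v)" if v: "v \<in> F ` U" for v
  proof -
    obtain e where e: "e > 0" "ball v e \<subseteq> F ` U" using oV v by (meson open_contains_ball)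
    show ?thesis
    proof (rule DERIV_inverse_function[where a = "v - e" and b = "v + e"])
      show "F (H y) = y" if "v - e < y" "y < v + e" for y
        using that e by (intro FH) (auto simp: dist_real_def subset_iff)
      show "isCont H v" using contH oV v continuous_on_eq_continuous_at by blast
    qed (use derF FH U(4) v e(1) in auto)
  qed
  \<comment> \<open>The local inverse \<open>H\<close> can be applied to \<open>G s\<close> only if
    \<open>G s\<close> is a value of \<open>F\<close> on \<open>U\<close>.\<close>
  define S' where "S' = S \<inter> G -` (F ` U)"
  have S': "open S'" "s0 \<in> S'" "smooth_on S' G"
    using continuous_open_preimage[OF contG S(1) oV] S imageI[OF U(2), of F] eq
      smooth_on_subset[OF S(3), of S']
    by (auto simp: S'_def)
  show thesis
  proof
    have "smooth_on S' (\<lambda>s. H (G s))"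
    proof (rule smooth_on_implicit[OF S'(1) U(3) S'(3)])
      fix s assume s: "s \<in> S'"
      have "((\<lambda>s. H (G s)) has_real_derivative
          inverse (nth_vderiv 1 F (H (G s))) * nth_vderiv 1 G s) (at s)"
        using s smooth_on_has_real_derivative[OF S'(3) s, of 0]
        by (intro DERIV_chain2[OF derH]) (auto simp: S'_def)
      then show "((\<lambda>s. H (G s)) has_real_derivative
          nth_vderiv 1 G s * inverse (nth_vderiv 1 F (H (G s)))) (at s)"
        by (simp add: mult.commute)
    qed (use FH U(4) in \<open>auto simp: S'_def\<close>)
    then show "smooth_near (\<lambda>s. H (G s)) s0"
      using S' by (auto simp: smooth_near_def)
    show "H (G s0) = t0" using H[OF U(2)] eq by simp
    \<comment> \<open>On this product both \<open>t\<close> and \<open>H (G s)\<close> lie in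
      \<open>U\<close>, and \<open>F (H (G s)) = G s\<close>, so injectivity of \<open>F\<close> on
      \<open>U\<close> gives the equivalence.\<close>
    have "\<forall>\<^sub>F p in nhds (t0, s0). p \<in> U \<times> S'"
      using U S' by (intro eventually_nhds_in_open open_Times) auto
    then show "\<forall>\<^sub>F (t, s) in nhds (t0, s0). F t = G s \<longleftrightarrow> t = H (G s)"
      by eventually_elim (use H FH inj in \<open>auto simp: S'_def inj_on_eq_iff\<close>)
  qed
qed

section \<open>Taylor coefficients from an expansion with error term\<close>

text \<open>The error bound cannot be differentiated termwise. Instead, once the lower derivatives
  of the error vanish at 0, Taylor's formula bounds its \<open>k\<close>-th derivative at some \<xi>
  with |\<xi>| \<le> |t| by a multiple of |t|^(N+1-k). As t tends to 0, so does \<xi>, and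
  continuity makes that derivative vanish at 0 too.\<close>

lemma nth_vderiv_0_eq_coeff:
  fixes f :: "real \<Rightarrow> real"
  assumes f: "smooth_near f 0"
    and O: "(\<lambda>t. f t - poly p t) \<in> O[nhds 0](\<lambda>t. t ^ Suc N)" and "k \<le> N"
  shows "nth_vderiv k f 0 = fact k * coeff p k"
proof -
  obtain S where "open S" "0 \<in> S" and S: "smooth_on S f"
    using f by (auto simp: smooth_near_def)
  then obtain r where r: "r > 0" "ball 0 r \<subseteq> S" by (meson open_contains_ball)
  \<comment> \<open>\<open>E n\<close> is the \<open>n\<close>-th derivative of the error
    \<open>f - p\<close>.\<close>
  define E where "E n t = nth_vderiv n f t - poly ((pderiv ^^ n) p) t" for n t
  have E: "(E n has_real_derivative E (Suc n) t) (at t)" if "\<bar>t\<bar> < r" for n t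
    unfolding E_def using r that
    by (auto intro!: DERIV_diff smooth_on_has_real_derivative[OF S] simp: subset_iff poly_DERIV)
  have contE: "E n \<midarrow>0\<rightarrow> E n 0" for n
    using E[of 0 n] r(1) by (intro isContD DERIV_isCont) auto
  obtain c where c: "\<forall>\<^sub>F t in nhds 0. \<bar>E 0 t\<bar> \<le> c * \<bar>t\<bar> ^ Suc N"
    using O by (elim landau_o.bigE) (simp add: E_def power_abs flip: power_Suc)
  have "E k 0 = 0"
    using \<open>k \<le> N\<close>
  proof (induction k rule: less_induct)
    case (less k)
    have taylor: "\<exists>\<xi>. \<bar>\<xi>\<bar> \<le> \<bar>t\<bar> \<and> \<bar>E k \<xi>\<bar> \<le> fact k * c * \<bar>t\<bar> ^ (Suc N - k)"
      if t: "t \<noteq> 0" "\<bar>t\<bar> < r" "\<bar>E 0 t\<bar> \<le> c * \<bar>t\<bar> ^ Suc N" for t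
    proof -
      obtain \<xi> where \<xi>: "\<bar>\<xi>\<bar> \<le> \<bar>t\<bar>"
        "E 0 t = (\<Sum>m<k. E m 0 / fact m * t ^ m) + E k \<xi> / fact k * t ^ k"
        using Maclaurin_bi_le[of E "E 0" k t] E t(2) by force
      have "(\<Sum>m<k. E m 0 / fact m * t ^ m) = 0"
        using less by (intro sum.neutral) auto
      with \<xi>(2) have "\<bar>E k \<xi>\<bar> * \<bar>t\<bar> ^ k = fact k * \<bar>E 0 t\<bar>"
        by (simp add: abs_mult power_abs)
      also have "\<dots> \<le> fact k * (c * \<bar>t\<bar> ^ Suc N)"
        using t(3) by (intro mult_left_mono) auto
      also have "\<bar>t\<bar> ^ Suc N = \<bar>t\<bar> ^ (Suc N - k) * \<bar>t\<bar> ^ k"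
        using less.prems by (simp flip: power_add)
      finally have "\<bar>E k \<xi>\<bar> * \<bar>t\<bar> ^ k \<le> (fact k * c * \<bar>t\<bar> ^ (Suc N - k)) * \<bar>t\<bar> ^ k"
        by (simp add: mult.assoc)
      then show ?thesis using \<xi>(1) t(1) by (auto intro: mult_right_le_imp_le)
    qed
    have "\<forall>\<^sub>F t in at 0. \<bar>t\<bar> < r"
      using r(1) by (auto simp: eventually_at)
    moreover have "\<forall>\<^sub>F t in at 0. \<bar>E 0 t\<bar> \<le> c * \<bar>t\<bar> ^ Suc N"
      using c by (simp add: eventually_nhds_conv_at)
    moreover have "\<forall>\<^sub>F t in at (0::real). t \<noteq> 0"
      by (rule eventually_neq_at_within)
    ultimately have "\<forall>\<^sub>F t in at 0. \<exists>\<xi>. \<bar>\<xi>\<bar> \<le> \<bar>t\<bar> \<and> \<bar>E k \<xi>\<bar> \<le> fact k * c * \<bar>t\<bar> ^ (Suc N - k)"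
      by eventually_elim (rule taylor)
    \<comment> \<open>Choosing the intermediate points as a function of \<open>t\<close> allows a
      limit to be taken along it.\<close>
    then obtain \<xi> where \<xi>: "\<forall>\<^sub>F t in at 0. \<bar>\<xi> t\<bar> \<le> \<bar>t\<bar> \<and> \<bar>E k (\<xi> t)\<bar> \<le> fact k * c * \<bar>t\<bar> ^ (Suc N - k)"
      unfolding eventually_ex ..
    have "((\<lambda>t. \<bar>t\<bar>) \<longlongrightarrow> 0) (at (0::real))"
      by (rule tendsto_eq_intros refl | simp)+
    then have "(\<xi> \<longlongrightarrow> 0) (at 0)"
      by (rule Lim_null_comparison[rotated]) (use \<xi> in eventually_elim, auto)
    then have "((\<lambda>t. E k (\<xi> t)) \<longlongrightarrow> E k 0) (at 0)"
      using contE by (intro isCont_tendsto_compose[where g = "E k"]) (auto simp: isCont_def)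
    moreover have "((\<lambda>t. E k (\<xi> t)) \<longlongrightarrow> 0) (at 0)"
    proof (rule Lim_null_comparison)
      show "\<forall>\<^sub>F t in at 0. norm (E k (\<xi> t)) \<le> fact k * c * \<bar>t\<bar> ^ (Suc N - k)"
        using \<xi> by eventually_elim auto
      \<comment> \<open>Here \<open>k \<le> N\<close> matters: the exponent is at least 1, so the
        bound tends to 0.\<close>
      show "((\<lambda>t. fact k * c * \<bar>t\<bar> ^ (Suc N - k)) \<longlongrightarrow> 0) (at 0)"
        using less.prems by (auto intro!: tendsto_eq_intros)
    qed
    ultimately show ?case by (intro tendsto_unique[of "at (0::real)"]) auto
  qed
  moreover have "poly ((pderiv ^^ k) p) 0 = fact k * coeff p k"
    by (simp add: poly_0_coeff_0 coeff_higher_pderiv pochhammer_fact)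
  ultimately show ?thesis by (simp add: E_def)
qed

section \<open>Differentiating identities that hold near a point\<close>

text \<open>Equality near \<open>x\<close> is also equality near every point close to
  \<open>x\<close>, so the derivatives agree there. The conclusion again concerns a whole
  neighbourhood, so the lemma can be iterated.\<close>

lemma eventually_deriv_unique:
  fixes u v :: "real \<Rightarrow> real"
  assumes eq: "\<forall>\<^sub>F s in nhds x. u s = v s"
    and u: "\<forall>\<^sub>F s in nhds x. (u has_real_derivative u' s) (at s)"
    and v: "\<forall>\<^sub>F s in nhds x. (v has_real_derivative v' s) (at s)"
  shows "\<forall>\<^sub>F s in nhds x. u' s = v' s"
proof -
  have "\<forall>\<^sub>F s in nhds x. \<forall>\<^sub>F r in nhds s. u r = v r"
    using eq by (simp add: eventually_eventually)
  then show ?thesis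
    using u v by eventually_elim (metis DERIV_cong_ev DERIV_unique)
qed

text \<open>Continuity is phrased with \<open>nhds x\<close> instead of \<open>at x\<close> so that
  eventual properties can be pulled back along \<open>f\<close> with the base point
  included.\<close>

lemma smooth_near_tendsto:
  fixes f :: "real \<Rightarrow> real"
  assumes "smooth_near f x"
  shows "(f \<longlongrightarrow> f x) (nhds x)"
  using eventually_nhds_x_imp_x[OF smooth_near_has_real_derivative[OF assms, of 0]]
  by (auto dest!: DERIV_isCont simp: isCont_def tendsto_at_iff_tendsto_nhds)

lemma eventually_deriv_comp:
  fixes f \<tau> :: "real \<Rightarrow> real"
  assumes f: "smooth_near f (\<tau> s0)" and \<tau>: "smooth_near \<tau> s0"
  shows "\<forall>\<^sub>F s in nhds s0. ((\<lambda>s. nth_vderiv n f (\<tau> s)) has_real_derivative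
    nth_vderiv (Suc n) f (\<tau> s) * nth_vderiv 1 \<tau> s) (at s)"
proof -
  have d\<tau>: "\<forall>\<^sub>F s in nhds s0. (\<tau> has_real_derivative nth_vderiv 1 \<tau> s) (at s)"
    using smooth_near_has_real_derivative[OF \<tau>, of 0] by simp
  from eventually_compose_filterlim[OF smooth_near_has_real_derivative[OF f, of n]
    smooth_near_tendsto[OF \<tau>]] d\<tau>
  show ?thesis by eventually_elim (rule DERIV_chain2)
qed

text \<open>One step in computing the successive derivatives of an explicitly given curve; the
  formula obtained holds near \<open>x\<close> and can be differentiated again.\<close>

lemma eventually_nth_vderiv_Suc:
  assumes eq: "\<forall>\<^sub>F s in nhds x. nth_vderiv n \<theta> s = X s"
    and X: "\<forall>\<^sub>F s in nhds x. (X has_vector_derivative X' s) (at s)"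
  shows "\<forall>\<^sub>F s in nhds x. nth_vderiv (Suc n) \<theta> s = X' s"
proof -
  have "\<forall>\<^sub>F s in nhds x. \<forall>\<^sub>F r in nhds s. nth_vderiv n \<theta> r = X r"
    using eq by (simp add: eventually_eventually)
  then show ?thesis
    using X
  proof eventually_elim
    case (elim s)
    have "(nth_vderiv n \<theta> has_vector_derivative X' s) (at s) \<longleftrightarrow> (X has_vector_derivative X' s) (at s)"
      by (rule has_vector_derivative_cong_ev) (use elim(1) in \<open>auto dest: eventually_nhds_x_imp_x\<close>)
    with elim(2) show ?case by (simp add: nth_vderiv_Suc vector_derivative_at)
  qed
qed

section \<open>Graph curves and parallel tangent lines\<close>

lemma smooth_near_snd:
  assumes "smooth_near g x"
  shows "smooth_near (\<lambda>t. snd (g t)) x"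
  using assms smooth_on_bounded_linear[OF _ _ bounded_linear_snd] by (auto simp: smooth_near_def)

lemma graph_vector_derivative:
  fixes g :: "real \<Rightarrow> real \<times> real"
  assumes g: "smooth_near g x" and graph: "\<forall>\<^sub>F t in nhds x. fst (g t) = t"
  shows "\<forall>\<^sub>F t in nhds x. vector_derivative g (at t) = (1, nth_vderiv 1 (\<lambda>t. snd (g t)) t)"
proof -
  have "\<forall>\<^sub>F t in nhds x. nth_vderiv 0 g t = (t, snd (g t))"
    using graph by eventually_elim (simp add: prod_eq_iff)
  moreover have "\<forall>\<^sub>F t in nhds x. ((\<lambda>t. (t, snd (g t))) has_vector_derivative
      (1, nth_vderiv 1 (\<lambda>t. snd (g t)) t)) (at t)"
    using smooth_near_has_real_derivative[OF smooth_near_snd[OF g], of 0]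
    by eventually_elim (auto intro!: derivative_intros simp: has_real_derivative_iff_has_vector_derivative)
  ultimately have "\<forall>\<^sub>F t in nhds x. nth_vderiv (Suc 0) g t = (1, nth_vderiv 1 (\<lambda>t. snd (g t)) t)"
    by (rule eventually_nth_vderiv_Suc)
  then show ?thesis by (simp add: nth_vderiv_Suc)
qed

text \<open>A translation between the lines sends the points with parameters 0 and 1 to points of
  the second line. Their difference makes \<open>(1, m)\<close> a multiple of \<open>(1, n)\<close>,
  and the first coordinate forces the factor 1.\<close>

lemma affine_parallel_tangent_line_iff:
  assumes "vector_derivative g (at t) = (1, m)" "vector_derivative k (at s) = (1, n)"
  shows "affine_parallel (tangent_line g t) (tangent_line k s) \<longleftrightarrow> m = n"
proof
  assume "affine_parallel (tangent_line g t) (tangent_line k s)"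
  then obtain a where a: "tangent_line k s = (\<lambda>x. a + x) ` tangent_line g t"
    by (auto simp: affine_parallel_def)
  have "\<exists>c. a + (g t + d *\<^sub>R (1, m)) = k s + c *\<^sub>R (1, n)" for d
  proof -
    have "a + (g t + d *\<^sub>R (1, m)) \<in> tangent_line k s"
      unfolding a by (auto simp: tangent_line_def assms)
    then show ?thesis by (auto simp: tangent_line_def assms)
  qed
  from this[of 0] this[of 1] obtain c d where
    "a + (g t + 0 *\<^sub>R (1, m)) = k s + c *\<^sub>R (1, n)" "a + (g t + 1 *\<^sub>R (1, m)) = k s + d *\<^sub>R (1, n)"
    by blast
  then have "1 = d - c" "m = (d - c) * n" by (auto simp: prod_eq_iff algebra_simps)
  then show "m = n" by simp
next
  assume "m = n"
  then have "tangent_line k s = (\<lambda>x. (k s - g t) + x) ` tangent_line g t"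
    by (auto simp: tangent_line_def assms image_image image_iff)
  then show "affine_parallel (tangent_line g t) (tangent_line k s)"
    unfolding affine_parallel_def by blast
qed

section \<open>Derivatives of the IPTL and of the parameter function\<close>

text \<open>The product rule applied repeatedly to the velocity (H, H g') with H = (1 - \<alpha>)
  \<tau>' + \<alpha>; \<open>h\<close> is the value of H at \<open>s0\<close>.\<close>

lemma intermediate_curve_nth_vderiv:
  fixes f g \<tau> :: "real \<Rightarrow> real" and \<theta> :: "real \<Rightarrow> real \<times> real"
  assumes f: "smooth_near f (\<tau> s0)" and g: "smooth_near g s0" and \<tau>: "smooth_near \<tau> s0"
    and par: "\<forall>\<^sub>F s in nhds s0. nth_vderiv 1 f (\<tau> s) = nth_vderiv 1 g s"
    and \<theta>: "\<forall>\<^sub>F s in nhds s0. \<theta> s = ((1 - \<alpha>) * \<tau> s + \<alpha> * s, (1 - \<alpha>) * f (\<tau> s) + \<alpha> * g s)"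
  defines "h \<equiv> (1 - \<alpha>) * nth_vderiv 1 \<tau> s0 + \<alpha>"
  shows "nth_vderiv 1 \<theta> s0 = (h, h * nth_vderiv 1 g s0)"
    and "nth_vderiv 2 \<theta> s0 = ((1 - \<alpha>) * nth_vderiv 2 \<tau> s0,
      (1 - \<alpha>) * nth_vderiv 2 \<tau> s0 * nth_vderiv 1 g s0 + h * nth_vderiv 2 g s0)"
    and "nth_vderiv 3 \<theta> s0 = ((1 - \<alpha>) * nth_vderiv 3 \<tau> s0,
      (1 - \<alpha>) * (nth_vderiv 3 \<tau> s0 * nth_vderiv 1 g s0 + 2 * nth_vderiv 2 \<tau> s0 * nth_vderiv 2 g s0)
      + h * nth_vderiv 3 g s0)"
    and "nth_vderiv 4 \<theta> s0 = ((1 - \<alpha>) * nth_vderiv 4 \<tau> s0,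
      (1 - \<alpha>) * (nth_vderiv 4 \<tau> s0 * nth_vderiv 1 g s0 + 3 * nth_vderiv 3 \<tau> s0 * nth_vderiv 2 g s0
        + 3 * nth_vderiv 2 \<tau> s0 * nth_vderiv 3 g s0) + h * nth_vderiv 4 g s0)"
proof -
  define T where "T n = nth_vderiv n \<tau>" for n
  define B where "B n = nth_vderiv n g" for n
  define H where "H s = (1 - \<alpha>) * T 1 s + \<alpha>" for s
  have T: "\<forall>\<^sub>F s in nhds s0. (T n has_real_derivative T (Suc n) s) (at s)" for n
    using smooth_near_has_real_derivative[OF \<tau>] by (simp add: T_def)
  have B: "\<forall>\<^sub>F s in nhds s0. (B n has_real_derivative B (Suc n) s) (at s)" for n
    using smooth_near_has_real_derivative[OF g] by (simp add: B_def)
  have dH: "\<forall>\<^sub>F s in nhds s0. (H has_real_derivative (1 - \<alpha>) * T 2 s) (at s)"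
    using T[of 1] unfolding H_def
    by eventually_elim (auto intro!: derivative_eq_intros simp: numeral_2_eq_2)
  \<comment> \<open>By \<open>par\<close> the factor f'(\<tau> s) of the chain rule becomes g'(s);
    hence no derivative of \<open>f\<close> appears in the formulas.\<close>
  have f\<tau>: "\<forall>\<^sub>F s in nhds s0. ((\<lambda>s. f (\<tau> s)) has_real_derivative B 1 s * T 1 s) (at s)"
    using eventually_deriv_comp[OF f \<tau>, of 0] par
    by eventually_elim (simp add: T_def B_def)
  have th0: "\<forall>\<^sub>F s in nhds s0. nth_vderiv 0 \<theta> s = ((1 - \<alpha>) * T 0 s + \<alpha> * s, (1 - \<alpha>) * f (\<tau> s) + \<alpha> * B 0 s)"
    using \<theta> by (simp add: T_def B_def)
  have "\<forall>\<^sub>F s in nhds s0. nth_vderiv (Suc 0) \<theta> s = (H s, H s * B 1 s)"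
  proof (rule eventually_nth_vderiv_Suc[OF th0])
    show "\<forall>\<^sub>F s in nhds s0. ((\<lambda>s. ((1 - \<alpha>) * T 0 s + \<alpha> * s, (1 - \<alpha>) * f (\<tau> s) + \<alpha> * B 0 s))
        has_vector_derivative (H s, H s * B 1 s)) (at s)"
      using T[of 0] B[of 0] f\<tau>
      by eventually_elim
        (auto intro!: has_vector_derivative_Pair derivative_eq_intros
          simp: H_def algebra_simps simp flip: has_real_derivative_iff_has_vector_derivative)
  qed
  then have th1: "\<forall>\<^sub>F s in nhds s0. nth_vderiv 1 \<theta> s = (H s, H s * B 1 s)" by simp
  have "\<forall>\<^sub>F s in nhds s0. nth_vderiv (Suc 1) \<theta> s =
      ((1 - \<alpha>) * T 2 s, (1 - \<alpha>) * T 2 s * B 1 s + H s * B 2 s)"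
  proof (rule eventually_nth_vderiv_Suc[OF th1])
    show "\<forall>\<^sub>F s in nhds s0. ((\<lambda>s. (H s, H s * B 1 s)) has_vector_derivative
        ((1 - \<alpha>) * T 2 s, (1 - \<alpha>) * T 2 s * B 1 s + H s * B 2 s)) (at s)"
      using dH B[of 1]
      by eventually_elim
        (auto intro!: has_vector_derivative_Pair derivative_eq_intros
          simp: numeral_2_eq_2 simp flip: has_real_derivative_iff_has_vector_derivative)
  qed
  then have th2: "\<forall>\<^sub>F s in nhds s0. nth_vderiv 2 \<theta> s =
      ((1 - \<alpha>) * T 2 s, (1 - \<alpha>) * T 2 s * B 1 s + H s * B 2 s)"
    by (simp add: numeral_2_eq_2)
  have "\<forall>\<^sub>F s in nhds s0. nth_vderiv (Suc 2) \<theta> s = ((1 - \<alpha>) * T 3 s,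
      (1 - \<alpha>) * (T 3 s * B 1 s + 2 * T 2 s * B 2 s) + H s * B 3 s)"
  proof (rule eventually_nth_vderiv_Suc[OF th2])
    show "\<forall>\<^sub>F s in nhds s0. ((\<lambda>s. ((1 - \<alpha>) * T 2 s, (1 - \<alpha>) * T 2 s * B 1 s + H s * B 2 s))
        has_vector_derivative ((1 - \<alpha>) * T 3 s,
          (1 - \<alpha>) * (T 3 s * B 1 s + 2 * T 2 s * B 2 s) + H s * B 3 s)) (at s)"
      using dH T[of 2, simplified] B[of 1, unfolded Suc_1] B[of 2, simplified]
      by eventually_elim
        (auto intro!: has_vector_derivative_Pair derivative_eq_intros
          simp: algebra_simps
          simp flip: has_real_derivative_iff_has_vector_derivative)
  qed
  then have th3: "\<forall>\<^sub>F s in nhds s0. nth_vderiv 3 \<theta> s = ((1 - \<alpha>) * T 3 s,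
      (1 - \<alpha>) * (T 3 s * B 1 s + 2 * T 2 s * B 2 s) + H s * B 3 s)"
    by (simp add: eval_nat_numeral)
  have "\<forall>\<^sub>F s in nhds s0. nth_vderiv (Suc 3) \<theta> s = ((1 - \<alpha>) * T 4 s,
      (1 - \<alpha>) * (T 4 s * B 1 s + 3 * T 3 s * B 2 s + 3 * T 2 s * B 3 s) + H s * B 4 s)"
  proof (rule eventually_nth_vderiv_Suc[OF th3])
    show "\<forall>\<^sub>F s in nhds s0. ((\<lambda>s. ((1 - \<alpha>) * T 3 s,
          (1 - \<alpha>) * (T 3 s * B 1 s + 2 * T 2 s * B 2 s) + H s * B 3 s))
        has_vector_derivative ((1 - \<alpha>) * T 4 s,
          (1 - \<alpha>) * (T 4 s * B 1 s + 3 * T 3 s * B 2 s + 3 * T 2 s * B 3 s) + H s * B 4 s)) (at s)"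
      using dH T[of 2, simplified] T[of 3, simplified] B[of 1, unfolded Suc_1]
        B[of 2, simplified] B[of 3, simplified]
      by eventually_elim
        (auto intro!: has_vector_derivative_Pair derivative_eq_intros simp: algebra_simps
          simp flip: has_real_derivative_iff_has_vector_derivative)
  qed
  then have th4: "\<forall>\<^sub>F s in nhds s0. nth_vderiv 4 \<theta> s = ((1 - \<alpha>) * T 4 s,
      (1 - \<alpha>) * (T 4 s * B 1 s + 3 * T 3 s * B 2 s + 3 * T 2 s * B 3 s) + H s * B 4 s)"
    by (simp add: eval_nat_numeral)
  note at = th1[THEN eventually_nhds_x_imp_x, unfolded H_def B_def T_def]
    th2[THEN eventually_nhds_x_imp_x, unfolded H_def B_def T_def]
    th3[THEN eventually_nhds_x_imp_x, unfolded H_def B_def T_def]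
    th4[THEN eventually_nhds_x_imp_x, unfolded H_def B_def T_def]
  show "nth_vderiv 1 \<theta> s0 = (h, h * nth_vderiv 1 g s0)"
    and "nth_vderiv 2 \<theta> s0 = ((1 - \<alpha>) * nth_vderiv 2 \<tau> s0,
      (1 - \<alpha>) * nth_vderiv 2 \<tau> s0 * nth_vderiv 1 g s0 + h * nth_vderiv 2 g s0)"
    and "nth_vderiv 3 \<theta> s0 = ((1 - \<alpha>) * nth_vderiv 3 \<tau> s0,
      (1 - \<alpha>) * (nth_vderiv 3 \<tau> s0 * nth_vderiv 1 g s0 + 2 * nth_vderiv 2 \<tau> s0 * nth_vderiv 2 g s0)
      + h * nth_vderiv 3 g s0)"
    and "nth_vderiv 4 \<theta> s0 = ((1 - \<alpha>) * nth_vderiv 4 \<tau> s0,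
      (1 - \<alpha>) * (nth_vderiv 4 \<tau> s0 * nth_vderiv 1 g s0 + 3 * nth_vderiv 3 \<tau> s0 * nth_vderiv 2 g s0
        + 3 * nth_vderiv 2 \<tau> s0 * nth_vderiv 3 g s0) + h * nth_vderiv 4 g s0)"
    unfolding h_def by (fact at)+
qed

text \<open>These come from differentiating f'(\<tau> s) = g'(s) three times. Where the second
  derivative of \<open>f\<close> is nonzero, they determine the first three derivatives of \<tau>
  one after another.\<close>

lemma parallel_function_nth_vderiv:
  fixes f g \<tau> :: "real \<Rightarrow> real"
  assumes f: "smooth_near f (\<tau> s0)" and g: "smooth_near g s0" and \<tau>: "smooth_near \<tau> s0"
    and par: "\<forall>\<^sub>F s in nhds s0. nth_vderiv 1 f (\<tau> s) = nth_vderiv 1 g s"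
  shows "nth_vderiv 2 f (\<tau> s0) * nth_vderiv 1 \<tau> s0 = nth_vderiv 2 g s0"
    and "nth_vderiv 3 f (\<tau> s0) * nth_vderiv 1 \<tau> s0 ^ 2 + nth_vderiv 2 f (\<tau> s0) * nth_vderiv 2 \<tau> s0
      = nth_vderiv 3 g s0"
    and "nth_vderiv 4 f (\<tau> s0) * nth_vderiv 1 \<tau> s0 ^ 3
        + 3 * nth_vderiv 3 f (\<tau> s0) * nth_vderiv 1 \<tau> s0 * nth_vderiv 2 \<tau> s0
        + nth_vderiv 2 f (\<tau> s0) * nth_vderiv 3 \<tau> s0
      = nth_vderiv 4 g s0"
proof -
  define T where "T n = nth_vderiv n \<tau>" for n
  define B where "B n = nth_vderiv n g" for n
  define A where "A n s = nth_vderiv n f (\<tau> s)" for n s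
  have T: "\<forall>\<^sub>F s in nhds s0. (T n has_real_derivative T (Suc n) s) (at s)" for n
    using smooth_near_has_real_derivative[OF \<tau>] by (simp add: T_def)
  have B: "\<forall>\<^sub>F s in nhds s0. (B n has_real_derivative B (Suc n) s) (at s)" for n
    using smooth_near_has_real_derivative[OF g] by (simp add: B_def)
  have A: "\<forall>\<^sub>F s in nhds s0. (A n has_real_derivative A (Suc n) s * T 1 s) (at s)" for n
    using eventually_deriv_comp[OF f \<tau>] unfolding A_def T_def .
  have e0: "\<forall>\<^sub>F s in nhds s0. A 1 s = B 1 s"
    using par by (simp add: A_def B_def)
  have "\<forall>\<^sub>F s in nhds s0. A (Suc 1) s * T 1 s = B (Suc 1) s"
    by (rule eventually_deriv_unique[OF e0 A B])
  then have e1: "\<forall>\<^sub>F s in nhds s0. A 2 s * T 1 s = B 2 s"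
    by (simp add: numeral_2_eq_2)
  have "\<forall>\<^sub>F s in nhds s0. ((\<lambda>s. A 2 s * T 1 s) has_real_derivative
      A 3 s * T 1 s ^ 2 + A 2 s * T 2 s) (at s)"
    using A[of 2] T[of 1] by eventually_elim
      (auto intro!: derivative_eq_intros simp: eval_nat_numeral algebra_simps)
  from eventually_deriv_unique[OF e1 this B]
  have e2: "\<forall>\<^sub>F s in nhds s0. A 3 s * T 1 s ^ 2 + A 2 s * T 2 s = B 3 s"
    by (simp add: eval_nat_numeral)
  have "\<forall>\<^sub>F s in nhds s0. ((\<lambda>s. A 3 s * T 1 s ^ 2 + A 2 s * T 2 s) has_real_derivative
      A 4 s * T 1 s ^ 3 + 3 * A 3 s * T 1 s * T 2 s + A 2 s * T 3 s) (at s)"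
    using A[of 2] A[of 3] T[of 1] T[of 2] by eventually_elim
      (auto intro!: derivative_eq_intros simp: eval_nat_numeral algebra_simps)
  from eventually_deriv_unique[OF e2 this B]
  have e3: "\<forall>\<^sub>F s in nhds s0. A 4 s * T 1 s ^ 3 + 3 * A 3 s * T 1 s * T 2 s + A 2 s * T 3 s = B 4 s"
    by (simp add: eval_nat_numeral)
  show "nth_vderiv 2 f (\<tau> s0) * nth_vderiv 1 \<tau> s0 = nth_vderiv 2 g s0"
    and "nth_vderiv 3 f (\<tau> s0) * nth_vderiv 1 \<tau> s0 ^ 2 + nth_vderiv 2 f (\<tau> s0) * nth_vderiv 2 \<tau> s0
      = nth_vderiv 3 g s0"
    and "nth_vderiv 4 f (\<tau> s0) * nth_vderiv 1 \<tau> s0 ^ 3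
        + 3 * nth_vderiv 3 f (\<tau> s0) * nth_vderiv 1 \<tau> s0 * nth_vderiv 2 \<tau> s0
        + nth_vderiv 2 f (\<tau> s0) * nth_vderiv 3 \<tau> s0
      = nth_vderiv 4 g s0"
    by (fact e1[THEN eventually_nhds_x_imp_x, unfolded A_def B_def T_def]
        e2[THEN eventually_nhds_x_imp_x, unfolded A_def B_def T_def]
        e3[THEN eventually_nhds_x_imp_x, unfolded A_def B_def T_def])+
qed

section \<open>Classification of the singularities of the IPTL\<close>

theorem proposition4p3:
  fixes I :: "real set" and \<gamma> \<gamma>1 \<gamma>2 :: "real \<Rightarrow> real \<times> real"
    and \<alpha> u1 u2 a3 a4 a5 b0 b1 b2 b3 b4 b5 :: real
  assumes curve: "smooth_plane_curve I \<gamma>"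
    and alpha: "0 < \<alpha>" "\<alpha> < 1"
    and points: "u1 \<in> I" "u2 \<in> I"
    and param1: "local_parametrization \<gamma> u1 \<gamma>1"
    and param2: "local_parametrization \<gamma> u2 \<gamma>2"
    and graph1: "\<forall>\<^sub>F t in nhds 0. fst (\<gamma>1 t) = t"
    and graph2: "\<forall>\<^sub>F s in nhds 0. fst (\<gamma>2 s) = s"
    and expansion1:
      "(\<lambda>t. snd (\<gamma>1 t) - (1/2 * t^2 + a3 * t^3 + a4 * t^4 + a5 * t^5)) \<in> O[nhds 0](\<lambda>t. t^6)"
    and expansion2:
      "(\<lambda>s. snd (\<gamma>2 s) - (b0 + b1 * s + b2 * s^2 + b3 * s^3 + b4 * s^4 + b5 * s^5))
         \<in> O[nhds 0](\<lambda>s. s^6)"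
    and "b0 > 0" and "a3 > 0"
    and parallel: "affine_parallel (tangent_line \<gamma>1 0) (tangent_line \<gamma>2 0)"
  shows "(\<exists>\<theta>. local_IPTL \<alpha> \<gamma>1 \<gamma>2 \<theta>) \<and>
    (\<forall>\<theta>. local_IPTL \<alpha> \<gamma>1 \<gamma>2 \<theta> \<longrightarrow>
       (\<theta> 0 = intermediate_point \<alpha> \<gamma>1 \<gamma>2 0 0 \<and>
        intermediate_point \<alpha> \<gamma>1 \<gamma>2 0 0 = (0, \<alpha> * b0)) \<and>
       (regular_at \<theta> 0 \<longleftrightarrow> b2 \<noteq> \<alpha> / (2 * (\<alpha> - 1))) \<and>
       (ordinary_cusp_at \<theta> 0 \<longleftrightarrow>
          b2 = \<alpha> / (2 * (\<alpha> - 1)) \<and> b3 \<noteq> (\<alpha> / (\<alpha> - 1))^2 * a3) \<and>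
       (cusp34_at \<theta> 0 \<longleftrightarrow>
          b2 = \<alpha> / (2 * (\<alpha> - 1)) \<and> b3 = (\<alpha> / (\<alpha> - 1))^2 * a3 \<and>
          b4 \<noteq> (\<alpha> / (\<alpha> - 1))^3 * a4))"
proof -
  define f where "f t = snd (\<gamma>1 t)" for t
  define g where "g s = snd (\<gamma>2 s)" for s
  have sm1: "smooth_near \<gamma>1 0" and sm2: "smooth_near \<gamma>2 0"
    using param1 param2 by (auto simp: local_parametrization_def)
  have f: "smooth_near f 0" and g: "smooth_near g 0"
    using smooth_near_snd[OF sm1] smooth_near_snd[OF sm2] by (simp_all add: f_def[abs_def] g_def[abs_def])
  have "(\<lambda>t. f t - poly [:0, 0, 1/2, a3, a4, a5:] t) \<in> O[nhds 0](\<lambda>t. t ^ Suc 5)"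
    using expansion1 by (simp add: f_def algebra_simps eval_nat_numeral)
  note f_coeff = nth_vderiv_0_eq_coeff[OF f this]
  have fd: "f 0 = 0" "nth_vderiv 1 f 0 = 0" "nth_vderiv 2 f 0 = 1" "nth_vderiv 3 f 0 = 6 * a3"
    "nth_vderiv 4 f 0 = 24 * a4"
    using f_coeff[of 0] f_coeff[of 1] f_coeff[of 2] f_coeff[of 3] f_coeff[of 4]
    by (simp_all add: eval_nat_numeral)
  have "(\<lambda>s. g s - poly [:b0, b1, b2, b3, b4, b5:] s) \<in> O[nhds 0](\<lambda>t. t ^ Suc 5)"
    using expansion2 by (simp add: g_def algebra_simps eval_nat_numeral)
  note g_coeff = nth_vderiv_0_eq_coeff[OF g this]
  have gd: "g 0 = b0" "nth_vderiv 1 g 0 = b1" "nth_vderiv 2 g 0 = 2 * b2" "nth_vderiv 3 g 0 = 6 * b3"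
    "nth_vderiv 4 g 0 = 24 * b4"
    using g_coeff[of 0] g_coeff[of 1] g_coeff[of 2] g_coeff[of 3] g_coeff[of 4]
    by (simp_all add: eval_nat_numeral)
  have tan1: "\<forall>\<^sub>F t in nhds 0. vector_derivative \<gamma>1 (at t) = (1, nth_vderiv 1 f t)"
    using graph_vector_derivative[OF sm1 graph1] by (simp add: f_def[abs_def])
  have tan2: "\<forall>\<^sub>F s in nhds 0. vector_derivative \<gamma>2 (at s) = (1, nth_vderiv 1 g s)"
    using graph_vector_derivative[OF sm2 graph2] by (simp add: g_def[abs_def])
  have b1: "b1 = 0"
    using parallel affine_parallel_tangent_line_iff[OF eventually_nhds_x_imp_x[OF tan1]
        eventually_nhds_x_imp_x[OF tan2]] fd(2) gd(2) by simp
  \<comment> \<open>The height b0/2 separates the two branches, so nearby points are distinct and a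
    parallel tangent pair is just a solution of f'(t) = g'(s).\<close>
  have "\<forall>\<^sub>F t in nhds 0. f t < b0 / 2" "\<forall>\<^sub>F s in nhds 0. b0 / 2 < g s"
    using \<open>b0 > 0\<close> order_tendstoD(2)[OF smooth_near_tendsto[OF f], of "b0 / 2"]
      order_tendstoD(1)[OF smooth_near_tendsto[OF g], of "b0 / 2"] fd(1) gd(1) by simp_all
  then have "\<forall>\<^sub>F p in nhds (0, 0).
      (vector_derivative \<gamma>1 (at (fst p)) = (1, nth_vderiv 1 f (fst p)) \<and> f (fst p) < b0 / 2) \<and>
      (vector_derivative \<gamma>2 (at (snd p)) = (1, nth_vderiv 1 g (snd p)) \<and> b0 / 2 < g (snd p))"
    unfolding nhds_prod using tan1 tan2 by (intro eventually_prodI eventually_conj)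
  then have pair: "\<forall>\<^sub>F p in nhds (0, 0).
      parallel_tangent_pair \<gamma>1 \<gamma>2 (fst p) (snd p) \<longleftrightarrow> nth_vderiv 1 f (fst p) = nth_vderiv 1 g (snd p)"
    by eventually_elim
      (auto simp: parallel_tangent_pair_def affine_parallel_tangent_line_iff f_def g_def)
  have "\<exists>\<theta>. local_IPTL \<alpha> \<gamma>1 \<gamma>2 \<theta>"
  proof -
    \<comment> \<open>The implicit function theorem is applied to f' and g': both vanish at 0
      because \<open>b1 = 0\<close>, and f''(0) = 1.\<close>
    obtain \<tau> where "smooth_near \<tau> 0" "\<tau> 0 = 0"
      and \<tau>: "\<forall>\<^sub>F (t, s) in nhds (0, 0). nth_vderiv 1 f t = nth_vderiv 1 g s \<longleftrightarrow> t = \<tau> s"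
      by (rule smooth_implicit_function[OF smooth_near_nth_vderiv[OF f] smooth_near_nth_vderiv[OF g], of 1 1])
        (use fd(2,3) gd(2) b1 in \<open>auto simp: nth_vderiv_nth_vderiv numeral_2_eq_2\<close>)
    moreover have "\<forall>\<^sub>F (t, s) in nhds (0, 0). parallel_tangent_pair \<gamma>1 \<gamma>2 t s \<longleftrightarrow> t = \<tau> s"
      using pair \<tau> by eventually_elim auto
    ultimately have "parallel_tangent_function \<gamma>1 \<gamma>2 \<tau>"
      by (simp add: parallel_tangent_function_def)
    then have "local_IPTL \<alpha> \<gamma>1 \<gamma>2 (\<lambda>s. intermediate_point \<alpha> \<gamma>1 \<gamma>2 (\<tau> s) s)"
      by (auto simp: local_IPTL_def)
    then show ?thesis by blast
  qed
  moreover have "(\<theta> 0 = intermediate_point \<alpha> \<gamma>1 \<gamma>2 0 0 \<and>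
        intermediate_point \<alpha> \<gamma>1 \<gamma>2 0 0 = (0, \<alpha> * b0)) \<and>
       (regular_at \<theta> 0 \<longleftrightarrow> b2 \<noteq> \<alpha> / (2 * (\<alpha> - 1))) \<and>
       (ordinary_cusp_at \<theta> 0 \<longleftrightarrow>
          b2 = \<alpha> / (2 * (\<alpha> - 1)) \<and> b3 \<noteq> (\<alpha> / (\<alpha> - 1))^2 * a3) \<and>
       (cusp34_at \<theta> 0 \<longleftrightarrow>
          b2 = \<alpha> / (2 * (\<alpha> - 1)) \<and> b3 = (\<alpha> / (\<alpha> - 1))^2 * a3 \<and>
          b4 \<noteq> (\<alpha> / (\<alpha> - 1))^3 * a4)"
    if "local_IPTL \<alpha> \<gamma>1 \<gamma>2 \<theta>" for \<theta>
  proof -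
    obtain \<tau> where \<tau>: "smooth_near \<tau> 0" "\<tau> 0 = 0"
      and graph: "\<forall>\<^sub>F (t, s) in nhds (0, 0). parallel_tangent_pair \<gamma>1 \<gamma>2 t s \<longleftrightarrow> t = \<tau> s"
      and \<theta>: "\<forall>\<^sub>F s in nhds 0. \<theta> s = intermediate_point \<alpha> \<gamma>1 \<gamma>2 (\<tau> s) s"
      using \<open>local_IPTL \<alpha> \<gamma>1 \<gamma>2 \<theta>\<close> by (auto simp: local_IPTL_def parallel_tangent_function_def)
    have \<tau>0: "(\<tau> \<longlongrightarrow> 0) (nhds 0)"
      using smooth_near_tendsto[OF \<tau>(1)] \<tau>(2) by simp
    then have "((\<lambda>s. (\<tau> s, s)) \<longlongrightarrow> (0, 0)) (nhds 0)"
      by (intro tendsto_Pair filterlim_ident)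
    \<comment> \<open>Pulling this back along s to (\<tau> s, s), which tends to (0, 0), turns the
      description of the pairs into an identity in \<open>s\<close> alone.\<close>
    moreover have "\<forall>\<^sub>F p in nhds (0, 0). fst p = \<tau> (snd p) \<longrightarrow>
        nth_vderiv 1 f (fst p) = nth_vderiv 1 g (snd p)"
      using pair graph by eventually_elim auto
    ultimately have par: "\<forall>\<^sub>F s in nhds 0. nth_vderiv 1 f (\<tau> s) = nth_vderiv 1 g s"
      by (auto dest: eventually_compose_filterlim[rotated])
    have "\<forall>\<^sub>F s in nhds 0. \<theta> s = ((1 - \<alpha>) * \<tau> s + \<alpha> * s, (1 - \<alpha>) * f (\<tau> s) + \<alpha> * g s)"
      using \<theta> graph2 eventually_compose_filterlim[OF graph1 \<tau>0]
      by eventually_elim (simp add: intermediate_point_def f_def g_def prod_eq_iff)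
    note D\<theta> = intermediate_curve_nth_vderiv[where \<tau> = \<tau> and f = f and g = g and ?s0.0 = 0,
        unfolded \<tau>(2) gd b1, OF f g \<tau>(1) par this]
    note D\<tau> = parallel_function_nth_vderiv[where \<tau> = \<tau> and f = f and g = g and ?s0.0 = 0,
        unfolded \<tau>(2) fd gd, OF f g \<tau>(1) par]
    \<comment> \<open>The values at 0 of h = (1 - \<alpha>) \<tau>' + \<alpha> and of its first two
      derivatives.\<close>
    define h0 h1 h2 where "h0 = (1 - \<alpha>) * nth_vderiv 1 \<tau> 0 + \<alpha>"
      and "h1 = (1 - \<alpha>) * nth_vderiv 2 \<tau> 0" and "h2 = (1 - \<alpha>) * nth_vderiv 3 \<tau> 0"
    \<comment> \<open>With this ratio the critical values of \<open>b2\<close>, \<open>b3\<close>,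
      \<open>b4\<close> are \<beta>/2, \<beta>^2 a3 and \<beta>^3 a4; at the critical
      \<open>b2\<close>, \<beta> is g''(0).\<close>
    define \<beta> where "\<beta> = \<alpha> / (\<alpha> - 1)"
    have "\<beta> \<noteq> 0" and \<beta>2: "\<alpha> / (2 * (\<alpha> - 1)) = \<beta> / 2" using alpha by (auto simp: \<beta>_def)
    have \<tau>1: "nth_vderiv 1 \<tau> 0 = 2 * b2"
      and \<tau>2: "nth_vderiv 2 \<tau> 0 = 6 * b3 - 24 * a3 * b2 ^ 2"
      and \<tau>3: "nth_vderiv 3 \<tau> 0 = 24 * b4 - 192 * a4 * b2 ^ 3 - 36 * a3 * b2 * nth_vderiv 2 \<tau> 0"
      using D\<tau> by (simp_all add: power_mult_distrib algebra_simps)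
    have h0: "h0 = 0 \<longleftrightarrow> b2 = \<beta> / 2"
      using alpha unfolding h0_def \<tau>1 \<beta>_def by (auto simp: field_simps)
    have h1: "h1 = 0 \<longleftrightarrow> b3 = \<beta> ^ 2 * a3" if "b2 = \<beta> / 2"
      using alpha unfolding h1_def \<tau>2 that by (auto simp: power_divide)
    \<comment> \<open>As \<alpha> is not 1, \<open>h1 = 0\<close> means \<tau>''(0) = 0, which
      removes the mixed term from \<open>\<tau>3\<close>; then 192 b2^3 = 24 \<beta>^3.\<close>
    have h2: "h2 = 0 \<longleftrightarrow> b4 = \<beta> ^ 3 * a4" if "b2 = \<beta> / 2" "h1 = 0"
      using that(2) alpha unfolding h1_def h2_def \<tau>3 that(1) by (auto simp: power_divide)
    have \<theta>1: "nth_vderiv 1 \<theta> 0 = (h0, 0)"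
      and \<theta>2: "nth_vderiv 2 \<theta> 0 = (h1, h0 * (2 * b2))"
      and \<theta>3: "nth_vderiv 3 \<theta> 0 = (h2, 4 * h1 * b2 + h0 * (6 * b3))"
      \<comment> \<open>The second component suffices: if \<open>h0\<close> and \<open>h1\<close>
        vanish, so does the second component of the third derivative, and the determinant no longer
        involves the first component of the fourth.\<close>
      and \<theta>4: "snd (nth_vderiv 4 \<theta> 0) = 6 * h2 * b2 + 18 * h1 * b3 + h0 * (24 * b4)"
      using D\<theta> by (simp_all add: h0_def h1_def h2_def algebra_simps)
    have det23: "det2 (nth_vderiv 2 \<theta> 0) (nth_vderiv 3 \<theta> 0) = 2 * \<beta> * h1 ^ 2"
      if "b2 = \<beta> / 2"
      using that h0 by (simp add: det2_def \<theta>2 \<theta>3 power2_eq_square)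
    have det34: "det2 (nth_vderiv 3 \<theta> 0) (nth_vderiv 4 \<theta> 0) = 3 * \<beta> * h2 ^ 2"
      if "b2 = \<beta> / 2" "h1 = 0"
      using that h0 by (simp add: det2_def \<theta>3 \<theta>4 power2_eq_square)
    have "\<theta> 0 = intermediate_point \<alpha> \<gamma>1 \<gamma>2 0 0"
      using eventually_nhds_x_imp_x[OF \<theta>] \<tau>(2) by simp
    moreover have "intermediate_point \<alpha> \<gamma>1 \<gamma>2 0 0 = (0, \<alpha> * b0)"
      using eventually_nhds_x_imp_x[OF graph1] eventually_nhds_x_imp_x[OF graph2] fd(1) gd(1)
      by (simp add: intermediate_point_def f_def g_def prod_eq_iff)
    moreover have "regular_at \<theta> 0 \<longleftrightarrow> b2 \<noteq> \<beta> / 2"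
      using h0 \<theta>1 by (simp add: regular_at_def zero_prod_def)
    \<comment> \<open>Since \<beta> is nonzero, the two determinants vanish exactly when
      \<open>h1\<close> and \<open>h2\<close> do, under the conditions of \<open>det23\<close> and
      \<open>det34\<close>.\<close>
    moreover have "ordinary_cusp_at \<theta> 0 \<longleftrightarrow> b2 = \<beta> / 2 \<and> b3 \<noteq> \<beta> ^ 2 * a3"
      using h0 h1 det23 \<open>\<beta> \<noteq> 0\<close> \<theta>1 by (auto simp: ordinary_cusp_at_def zero_prod_def)
    moreover have "cusp34_at \<theta> 0 \<longleftrightarrow> b2 = \<beta> / 2 \<and> b3 = \<beta> ^ 2 * a3 \<and> b4 \<noteq> \<beta> ^ 3 * a4"
      using h0 h1 h2 det23 det34 \<open>\<beta> \<noteq> 0\<close> \<theta>1 by (auto simp: cusp34_at_def zero_prod_def)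
    ultimately show ?thesis
      unfolding \<beta>2 \<beta>_def[symmetric] by blast
  qed
  ultimately show ?thesis by blast
qed

end
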